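(* Let $m\ge1$, $r\ge2$, $n\ge0$ be integers with $r>m-n$. Then \[ ( - 1)^{m - 1} \sum_{p = 0}^n ( - 1)^p \binom mp T(r - m + p,\,m,\,n - p + 1) = E(n + 1,r) + ( - 1)^n \sum_{i = n + 1}^{m - 1} ( - 1)^i \binom in\zeta (i + 1)\zeta (r - i + n). \]
   Context: $H_{\nu,k}=\sum_{j=1}^\nu j^{-k}$; $E(m,n)=\sum_{\nu=1}^\infty H_{\nu,m}/\nu^n$ is the linear Euler sum; for integers $r,s,t$, $T(r,s,t)=\sum_{\mu=1}^\infty\sum_{\nu=1}^\infty \frac{1}{\mu^r\nu^s(\mu+\nu)^t}$ is the Tornheim double series (arguments may be zero or negative); $\zeta$ is the Riemann zeta function. $\binom mp=0$ for $p>m\ge0$. Summation convention: for integers $a>b$, $\sum_{i=a}^b f_i:=-\sum_{i=b+1}^{a-1}f_i$ (so $\sum_{i=a}^{a-1}f_i=0$). *)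

theory Defs
  imports "HOL-Analysis.Analysis"
begin

definition harm_num :: "nat \<Rightarrow> int \<Rightarrow> real" where
  "harm_num \<nu> k = (\<Sum>j = 1..\<nu>. 1 / real j powi k)"

(* The infinite series below run over the positive integers: the bound index starts at 0
   and the summand is evaluated at its successor. *)

definition euler_sum :: "int \<Rightarrow> int \<Rightarrow> real" where
  "euler_sum m n = (\<Sum>\<nu>. harm_num (Suc \<nu>) m / real (Suc \<nu>) powi n)"

definition tornheim :: "int \<Rightarrow> int \<Rightarrow> int \<Rightarrow> real" where
  "tornheim r s t =
     (\<Sum>\<mu>. \<Sum>\<nu>. 1 / (real (Suc \<mu>) powi r * real (Suc \<nu>) powi s
                        * real (Suc \<mu> + Suc \<nu>) powi t))"

(* The Riemann zeta function on the half-line s > 1, where it is given by its Dirichlet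
   series; for s \<le> 1 the series diverges and the value is meaningless. *)
definition zeta :: "real \<Rightarrow> real" where
  "zeta s = (\<Sum>\<nu>. 1 / real (Suc \<nu>) powr s)"

(* Sum from a to b with the convention that, for a > b, it is minus the sum
   from b + 1 to a - 1 (hence 0 for a = b + 1). *)
definition signed_sum :: "(int \<Rightarrow> real) \<Rightarrow> int \<Rightarrow> int \<Rightarrow> real" where
  "signed_sum f a b = (if a \<le> b then \<Sum>i = a..b. f i else - (\<Sum>i = b + 1..a - 1. f i))"

end

theory Submission
  imports Defs "HOL-Real_Asymp.Real_Asymp"
begin

text \<open>Write \<open>s = \<mu> + \<nu>\<close>. Multiplied by \<open>\<mu>\<^sup>r\<close>, the combined summand on the left is a binomial expansion of
  \<open>(\<mu> - s)\<^sup>m = (- \<nu>)\<^sup>m\<close>, cut off after the term with index \<open>n\<close> and divided by \<open>s\<^bsup>n+1\<^esup> \<nu>\<^sup>m\<close>.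
  Raising \<open>m\<close> by one changes it by a single term in \<open>\<mu>\<^bsup>m-n\<^esup> \<nu>\<^bsup>-m-1\<^esup>\<close>, so it equals
  \<open>\<nu>\<^bsup>-n-1\<^esup> - s\<^bsup>-n-1\<^esup>\<close> plus a signed sum of such terms. Summing over \<open>\<nu>\<close> telescopes the
  difference to a generalised harmonic number and turns the other terms into zeta values; the
  sum over \<open>\<mu>\<close> then gives the Euler sum and the second zeta factors.\<close>

text \<open>The convention for reversed bounds is what makes this recurrence unconditional, so an
  induction on the upper bound may start below \<open>a\<close>.\<close>

lemma signed_sum_step:
  "signed_sum f a (b + 1) = signed_sum f a b + f (b + 1)"
proof -
  consider "a \<le> b" | "a = b + 1" | "a > b + 1" by linarith
  then show ?thesis
  proof cases
    case 1
    then have "{a..b + 1} = insert (b + 1) {a..b}" by auto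
    with 1 show ?thesis by (simp add: signed_sum_def)
  next
    case 2
    then show ?thesis by (simp add: signed_sum_def)
  next
    case 3
    then have "{b + 1..a - 1} = insert (b + 1) {b + 1 + 1..a - 1}" by auto
    with 3 show ?thesis by (simp add: signed_sum_def)
  qed
qed

lemma signed_sum_cmult: "c * signed_sum f a b = signed_sum (\<lambda>i. c * f i) a b"
  by (simp add: signed_sum_def sum_distrib_left)

text \<open>The index range in the hypothesis is \<open>{a..b}\<close> or
  \<open>{b + 1..a - 1}\<close>, depending on the order of the bounds, so convergence is asked only
  for terms that occur.\<close>

lemma sums_signed_sum:
  assumes "\<And>i. min a (b + 1) \<le> i \<Longrightarrow> i \<le> max b (a - 1) \<Longrightarrow> f i sums g i"
  shows "(\<lambda>k. signed_sum (\<lambda>i. f i k) a b) sums signed_sum g a b"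
  unfolding signed_sum_def using assms
  by (auto intro!: sums_sum sums_minus)

text \<open>Induction on \<open>m\<close> with \<open>n\<close> fixed: each step contributes exactly
  the summand \<open>i = m\<close> of the signed sum. Powers of \<open>x\<close> have integer
  exponents because \<open>p\<close> may exceed \<open>m\<close>.\<close>

lemma partial_fractions_signed_sum:
  fixes x y :: real and m n :: nat
  assumes "x > 0" "y > 0"
  shows "(-1) ^ (m + 1) * (\<Sum>p\<le>n. (-1) ^ p * real (m choose p) * x powi (int m - int p) * (x + y) ^ p)
           / ((x + y) ^ (n + 1) * y ^ m)
         = 1 / y ^ (n + 1) - 1 / (x + y) ^ (n + 1)
           + (-1) ^ n * signed_sum (\<lambda>i. (-1) powi i * real (nat i choose n) * x powi (i - int n) / y powi (i + 1))
               (int n + 1) (int m - 1)"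
proof (induction m)
  case 0
  have "(\<Sum>p\<le>n. (-1) ^ p * real (0 choose p) * x powi (int 0 - int p) * (x + y) ^ p)
      = (\<Sum>p\<in>{0}. (-1) ^ p * real (0 choose p) * x powi (int 0 - int p) * (x + y) ^ p)"
    by (rule sum.mono_neutral_right) auto
  \<comment> \<open>For \<open>m = 0\<close> the bounds are reversed and the signed sum is minus a
    sum over \<open>0..n\<close>. Only \<open>i = n\<close> survives, and it cancels
    \<open>1 / y ^ (n + 1)\<close>.\<close>
  moreover have "(\<Sum>i = 0..int n. (-1) powi i * real (nat i choose n) * x powi (i - int n) / y powi (i + 1))
      = (\<Sum>i\<in>{int n}. (-1) powi i * real (nat i choose n) * x powi (i - int n) / y powi (i + 1))"
    by (rule sum.mono_neutral_right) (auto simp: nat_less_iff intro!: binomial_eq_0)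
  ultimately show ?case
    by (simp add: signed_sum_def power_int_add_1 assms flip: power_mult_distrib)
next
  case (Suc m)
  define S where "S m = (\<Sum>p\<le>n. (-1) ^ p * real (m choose p) * x powi (int m - int p) * (x + y) ^ p)" for m
  define c where "c = (-1) ^ n * real (m choose n) * x powi (int m - int n) * (x + y) ^ (n + 1)"
  \<comment> \<open>Pascal's rule gives \<open>x * S m\<close> minus \<open>(x + y)\<close> times
    the sum of \<open>t p\<close> over \<open>p < n\<close>. The cut-off at \<open>n\<close> thus
    leaves \<open>c = (x + y) * t n\<close>.\<close>
  have rec: "S (Suc m) = - y * S m + c"
  proof -
    define t where "t p = (-1) ^ p * real (m choose p) * x powi (int m - int p) * (x + y) ^ p" for p
    define u where "u p = (if p = 0 then 0 else (x + y) * t (p - 1))" for p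
    have "(-1) ^ p * real (Suc m choose p) * x powi (int (Suc m) - int p) * (x + y) ^ p = x * t p - u p" for p
    proof (cases p)
      case 0
      then show ?thesis using assms by (simp add: t_def u_def power_int_add)
    next
      case (Suc q)
      have "x powi (int m - int q) = x * x powi (int m - int (Suc q))"
        using assms by (simp add: power_int_diff power_int_add)
      with Suc show ?thesis using assms by (simp add: t_def u_def algebra_simps)
    qed
    then have "S (Suc m) = x * S m - (\<Sum>p\<le>n. u p)"
      by (simp add: S_def t_def sum_subtractf sum_distrib_left)
    also have "(\<Sum>p\<le>n. u p) = (x + y) * (S m - t n)"
      by (simp add: S_def flip: t_def, induction n)
        (simp_all add: u_def algebra_simps)
    finally show ?thesis by (simp add: c_def t_def algebra_simps)
  qed
  have "(-1) ^ (Suc m + 1) * S (Suc m) / ((x + y) ^ (n + 1) * y ^ Suc m)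
      = (-1) ^ (m + 1) * S m / ((x + y) ^ (n + 1) * y ^ m)
        + (-1) ^ m * c / ((x + y) ^ (n + 1) * y ^ Suc m)"
    using assms unfolding rec by (simp add: divide_simps) (simp add: algebra_simps)
  also have "(-1) ^ m * c / ((x + y) ^ (n + 1) * y ^ Suc m)
      = (-1) ^ n * ((-1) powi int m * real (nat (int m) choose n) * x powi (int m - int n) / y powi (int m + 1))"
    using assms by (simp add: c_def power_int_add_1 divide_simps)
  finally show ?case
    using signed_sum_step[of "\<lambda>i. (-1) powi i * real (nat i choose n) * x powi (i - int n) / y powi (i + 1)"
        "int n + 1" "int m - 1"] Suc.IH
    unfolding S_def by (simp add: distrib_left)
qed

text \<open>Raising \<open>x\<close> by one adds a telescoping series with terms tending to 0.
  Keeping the difference together covers \<open>k = 1\<close>, where the two series diverge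
  separately.\<close>

lemma sums_shift_difference_harm_num:
  fixes k :: int
  assumes "k \<ge> 1"
  shows "(\<lambda>\<nu>. 1 / real (Suc \<nu>) powi k - 1 / (real x + real (Suc \<nu>)) powi k) sums harm_num x k"
proof (induction x)
  case 0
  show ?case by (simp add: harm_num_def)
next
  case (Suc x)
  obtain j where k: "k = int (Suc j)"
    using assms by (metis Suc_pred' int_one_le_iff_zero_less of_nat_0_less_iff zero_less_imp_eq_int)
  have "(\<lambda>\<nu>. 1 / (real x + real (Suc \<nu>)) powi k) \<longlonglongrightarrow> 0"
    unfolding k power_int_of_nat by real_asymp
  from telescope_sums'[OF this]
  have "(\<lambda>\<nu>. 1 / (real x + real (Suc \<nu>)) powi k - 1 / (real (Suc x) + real (Suc \<nu>)) powi k)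
      sums (1 / real (Suc x) powi k)"
    by (simp add: algebra_simps)
  from sums_add[OF Suc.IH this] show ?case
    by (simp add: harm_num_def)
qed

lemma summable_inverse_powr:
  assumes "s > 1"
  shows "summable (\<lambda>\<nu>. 1 / real (Suc \<nu>) powr s)"
  using assms summable_real_powr_iff[of "-s"] summable_Suc_iff[of "\<lambda>\<nu>. real \<nu> powr (-s)"]
  by (simp add: powr_minus_divide)

lemma zeta_sums:
  assumes "k \<ge> 2"
  shows "(\<lambda>\<nu>. 1 / real (Suc \<nu>) powi k) sums zeta (real_of_int k)"
  using summable_inverse_powr[of "real_of_int k"] assms
  by (simp add: zeta_def powr_real_of_int' summable_sums)

text \<open>Half a power of \<open>x + y\<close> is given to each variable, which makes both
  iterated sums converge.\<close>

lemma tornheim_term_le: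
  fixes x y :: real and r s t :: int
  assumes "x > 0" "y > 0" "t \<ge> 1"
  shows "1 / (x powi r * y powi s * (x + y) powi t)
         \<le> (1 / x powr (r + t - 1/2)) * (1 / y powr (s + 1/2))"
proof -
  \<comment> \<open>One factor \<open>x + y\<close> is bounded below by the square root of
    \<open>x * y\<close>, the remaining \<open>j\<close> factors by \<open>x ^ j\<close>.\<close>
  obtain j where t: "t = int j + 1"
    using assms(3) by (metis add.commute zle_iff_zadd)
  have "x powr (1/2) * y powr (1/2) \<le> (x + y) powr (1/2) * (x + y) powr (1/2)"
    using assms by (intro mult_mono powr_mono2) auto
  also have "\<dots> = x + y"
    using assms by (simp flip: powr_add)
  finally have "x ^ j * (x powr (1/2) * y powr (1/2)) \<le> (x + y) ^ j * (x + y)"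
    using assms by (intro mult_mono power_mono) auto
  then have "x powi r * y powi s * (x ^ j * (x powr (1/2) * y powr (1/2)))
      \<le> x powi r * y powi s * (x + y) powi t"
    using assms by (intro mult_left_mono) (auto simp: t power_int_add_1)
  moreover have "x powi r * y powi s * (x ^ j * (x powr (1/2) * y powr (1/2)))
      = x powr (r + t - 1/2) * y powr (s + 1/2)"
    using assms
    by (simp add: t powr_add powr_diff powr_realpow flip: powr_real_of_int')
  ultimately have "x powr (r + t - 1/2) * y powr (s + 1/2) \<le> x powi r * y powi s * (x + y) powi t"
    by simp
  then show ?thesis
    using assms by (simp add: divide_simps)
qed

text \<open>Both exponents of the majorant are at least 3/2, so a product of two convergent series
  dominates. This lets the finite sum over \<open>p\<close> pass through both infinite sums.\<close>

lemma tornheim_summable: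
  fixes r s t :: int
  assumes "s \<ge> 1" "t \<ge> 1" "r + t \<ge> 2"
  defines "a \<equiv> \<lambda>\<mu> \<nu>. 1 / (real (Suc \<mu>) powi r * real (Suc \<nu>) powi s * real (Suc \<mu> + Suc \<nu>) powi t)"
  shows "summable (a \<mu>)" "summable (\<lambda>\<mu>. \<Sum>\<nu>. a \<mu> \<nu>)"
proof -
  let ?X = "\<lambda>\<mu>. 1 / real (Suc \<mu>) powr (r + t - 1/2)" and ?Y = "\<lambda>\<nu>. 1 / real (Suc \<nu>) powr (s + 1/2)"
  have le: "a \<mu> \<nu> \<le> ?X \<mu> * ?Y \<nu>" and nonneg: "0 \<le> a \<mu> \<nu>" for \<mu> \<nu>
    using tornheim_term_le[of "real (Suc \<mu>)" "real (Suc \<nu>)" t r s] assms(2)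
    by (simp_all add: a_def)
  have X: "summable ?X" and Y: "summable ?Y"
    by (rule summable_inverse_powr, use assms in linarith)+
  show *: "summable (a \<mu>)" for \<mu>
    by (rule summable_comparison_test'[OF summable_mult[OF Y, of "?X \<mu>"], of 0])
      (use le nonneg in simp)
  show "summable (\<lambda>\<mu>. \<Sum>\<nu>. a \<mu> \<nu>)"
  proof (rule summable_comparison_test'[OF summable_mult2[OF X, of "suminf ?Y"], of 0])
    fix \<mu>
    have "(\<Sum>\<nu>. a \<mu> \<nu>) \<le> (\<Sum>\<nu>. ?X \<mu> * ?Y \<nu>)"
      by (rule suminf_le[OF le * summable_mult[OF Y]])
    also have "\<dots> = ?X \<mu> * suminf ?Y"
      by (rule suminf_mult[OF Y])
    finally show "norm (\<Sum>\<nu>. a \<mu> \<nu>) \<le> ?X \<mu> * suminf ?Y"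
      using suminf_nonneg[OF * nonneg] by simp
  qed
qed

theorem theorem3p2:
  fixes m r n :: int
  assumes "m \<ge> 1" and "r \<ge> 2" and "n \<ge> 0" and "r > m - n"
  shows "(-1) powi (m - 1) *
           (\<Sum>p = 0..n. (-1) powi p * real (nat m choose nat p) * tornheim (r - m + p) m (n - p + 1))
         = euler_sum (n + 1) r
           + (-1) powi n *
             signed_sum (\<lambda>i. (-1) powi i * real (nat i choose nat n)
                               * zeta (real_of_int (i + 1)) * zeta (real_of_int (r - i + n)))
               (n + 1) (m - 1)"
proof -
  define X where "X \<mu> = real (Suc \<mu>)" for \<mu>
  have X: "X \<mu> > 0" for \<mu> by (simp add: X_def)
  define c where "c p = (-1) powi p * real (nat m choose nat p)" for p
  define a where "a p \<mu> \<nu> = 1 / (X \<mu> powi (r - m + p) * X \<nu> powi m * (X \<mu> + X \<nu>) powi (n - p + 1))"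
    for p \<mu> \<nu>
  have tornheim: "tornheim (r - m + p) m (n - p + 1) = (\<Sum>\<mu>. \<Sum>\<nu>. a p \<mu> \<nu>)" for p
    by (simp only: tornheim_def a_def X_def of_nat_add)
  have a_summable: "summable (a p \<mu>)" "summable (\<lambda>\<mu>. \<Sum>\<nu>. a p \<mu> \<nu>)" if "p \<in> {0..n}" for p \<mu>
  proof -
    \<comment> \<open>The second quantity is \<open>r - m + n + 1\<close> for every
      \<open>p\<close>; the hypothesis \<open>r > m - n\<close> bounds it.\<close>
    have "n - p + 1 \<ge> 1" "(r - m + p) + (n - p + 1) \<ge> 2"
      using that assms by auto
    from tornheim_summable[OF assms(1) this]
    show "summable (a p \<mu>)" "summable (\<lambda>\<mu>. \<Sum>\<nu>. a p \<mu> \<nu>)"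
      by (simp_all only: a_def[abs_def] X_def of_nat_add)
  qed
  define d where "d i = (-1) powi i * real (nat i choose nat n)" for i
  define G where "G \<mu> \<nu> = 1 / X \<nu> powi (n + 1) - 1 / (X \<mu> + X \<nu>) powi (n + 1)
     + (-1) powi n * signed_sum (\<lambda>i. d i * X \<mu> powi (i - n) * (1 / X \<nu> powi (i + 1))) (n + 1) (m - 1)"
    for \<mu> \<nu>
  have pointwise: "(-1) powi (m - 1) * (\<Sum>p = 0..n. c p * a p \<mu> \<nu>) = 1 / X \<mu> powi r * G \<mu> \<nu>" for \<mu> \<nu>
  proof -
    obtain M N where M: "m = int M" and N: "n = int N"
      using assms by (metis zero_le_imp_eq_int order_trans zero_le_one)
    let ?s = "X \<mu> + X \<nu>"
    have s: "?s > 0" using X[of \<mu>] X[of \<nu>] by simp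
    have "c (int p) * a (int p) \<mu> \<nu>
        = 1 / X \<mu> powi r * ((-1) ^ p * real (M choose p) * X \<mu> powi (int M - int p) * ?s ^ p / (?s ^ (N + 1) * X \<nu> ^ M))"
      for p
      using X[of \<mu>] X[of \<nu>] s
      by (simp add: c_def a_def M N power_int_diff power_int_add divide_simps)
    then have "(\<Sum>p = 0..n. c p * a p \<mu> \<nu>)
        = (\<Sum>p\<le>N. 1 / X \<mu> powi r * ((-1) ^ p * real (M choose p) * X \<mu> powi (int M - int p) * ?s ^ p / (?s ^ (N + 1) * X \<nu> ^ M)))"
      unfolding N
      by (intro sum.reindex_cong[of int]) (auto simp: image_int_atLeastAtMost atMost_atLeast0)
    also have "\<dots> = 1 / X \<mu> powi r * ((\<Sum>p\<le>N. (-1) ^ p * real (M choose p) * X \<mu> powi (int M - int p) * ?s ^ p) / (?s ^ (N + 1) * X \<nu> ^ M))"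
      by (simp only: sum_distrib_left sum_divide_distrib)
    finally have "(-1) powi (m - 1) * (\<Sum>p = 0..n. c p * a p \<mu> \<nu>)
       = 1 / X \<mu> powi r * ((-1) ^ (M + 1) * (\<Sum>p\<le>N. (-1) ^ p * real (M choose p) * X \<mu> powi (int M - int p) * ?s ^ p) / (?s ^ (N + 1) * X \<nu> ^ M))"
      by (simp add: M power_int_diff)
    also have "\<dots> = 1 / X \<mu> powi r * G \<mu> \<nu>"
      unfolding partial_fractions_signed_sum[OF X X]
      using s by (simp add: G_def d_def M N power_int_add_1 mult.commute)
    finally show ?thesis .
  qed
  define g where "g \<mu> = harm_num (Suc \<mu>) (n + 1)
     + (-1) powi n * signed_sum (\<lambda>i. d i * X \<mu> powi (i - n) * zeta (real_of_int (i + 1))) (n + 1) (m - 1)" for \<mu>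
  have G: "G \<mu> sums g \<mu>" for \<mu>
    unfolding G_def g_def
  proof (intro sums_add sums_mult sums_signed_sum)
    show "(\<lambda>\<nu>. 1 / X \<nu> powi (n + 1) - 1 / (X \<mu> + X \<nu>) powi (n + 1)) sums harm_num (Suc \<mu>) (n + 1)"
      unfolding X_def using assms(3) by (intro sums_shift_difference_harm_num) simp
  next
    \<comment> \<open>As \<open>n + 1\<close> and \<open>m\<close> are both at least 1, so is
      \<open>i\<close> in either orientation, and the zeta argument is at least 2.\<close>
    fix i assume "min (n + 1) (m - 1 + 1) \<le> i"
    then show "(\<lambda>\<nu>. 1 / X \<nu> powi (i + 1)) sums zeta (real_of_int (i + 1))"
      unfolding X_def using assms by (intro zeta_sums) linarith
  qed
  \<comment> \<open>The same series in \<open>\<nu>\<close> is summed twice, once termwise in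
    \<open>p\<close> and once through \<open>G\<close>.\<close>
  have inner: "(-1) powi (m - 1) * (\<Sum>p = 0..n. c p * (\<Sum>\<nu>. a p \<mu> \<nu>)) = 1 / X \<mu> powi r * g \<mu>" for \<mu>
  proof (rule sums_unique2)
    show "(\<lambda>\<nu>. (-1) powi (m - 1) * (\<Sum>p = 0..n. c p * a p \<mu> \<nu>))
        sums ((-1) powi (m - 1) * (\<Sum>p = 0..n. c p * (\<Sum>\<nu>. a p \<mu> \<nu>)))"
      by (intro sums_mult sums_sum summable_sums a_summable)
    show "(\<lambda>\<nu>. (-1) powi (m - 1) * (\<Sum>p = 0..n. c p * a p \<mu> \<nu>)) sums (1 / X \<mu> powi r * g \<mu>)"
      unfolding pointwise by (intro sums_mult G)
  qed
  define T where "T = (-1) powi (m - 1) * (\<Sum>p = 0..n. c p * tornheim (r - m + p) m (n - p + 1))"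
  define Z where "Z = (-1) powi n * signed_sum (\<lambda>i. d i * zeta (real_of_int (i + 1)) * zeta (real_of_int (r - i + n))) (n + 1) (m - 1)"
  have T: "(\<lambda>\<mu>. 1 / X \<mu> powi r * g \<mu>) sums T"
    unfolding inner[symmetric] T_def tornheim
    by (intro sums_mult sums_sum summable_sums a_summable)
  have Z: "(\<lambda>\<mu>. (-1) powi n * signed_sum (\<lambda>i. d i * zeta (real_of_int (i + 1)) * (1 / X \<mu> powi (r - i + n))) (n + 1) (m - 1)) sums Z"
    \<comment> \<open>The argument \<open>r - i + n\<close> is at least 2: for
      \<open>i \<le> m - 1\<close> by \<open>r > m - n\<close>, and for \<open>i \<le> n\<close> by
      \<open>r \<ge> 2\<close>.\<close>
    unfolding Z_def X_def using assms
    by (intro sums_mult sums_signed_sum zeta_sums) (auto simp: max_def split: if_splits)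
  have split: "1 / X \<mu> powi r * g \<mu> = harm_num (Suc \<mu>) (n + 1) / X \<mu> powi r
    + (-1) powi n * signed_sum (\<lambda>i. d i * zeta (real_of_int (i + 1)) * (1 / X \<mu> powi (r - i + n))) (n + 1) (m - 1)" for \<mu>
  proof -
    have "1 / X \<mu> powi r * (d i * X \<mu> powi (i - n) * zeta (real_of_int (i + 1)))
        = d i * zeta (real_of_int (i + 1)) * (1 / X \<mu> powi (r - i + n))" for i
      using X[of \<mu>] by (simp add: power_int_diff power_int_add)
    then show ?thesis
      unfolding g_def distrib_left mult.left_commute[of "1 / X \<mu> powi r" "(-1) powi n"] signed_sum_cmult[of "1 / X \<mu> powi r"]
      by simp
  qed
  \<comment> \<open>Convergence of the Euler sum is obtained here too, from a difference of two
    convergent series.\<close>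
  have "(\<lambda>\<mu>. harm_num (Suc \<mu>) (n + 1) / X \<mu> powi r) sums (T - Z)"
    using sums_diff[OF T Z] by (simp only: split add_diff_cancel_right')
  then have "euler_sum (n + 1) r = T - Z"
    by (simp add: euler_sum_def X_def sums_iff)
  then show ?thesis
    by (simp add: T_def Z_def c_def d_def)
qed

end
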